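(* Let $X=(X,\varphi)$ be a $\check C_0$-complete $\mathbf r$-exterior flow. Then: (i) For any $x\in X$, the net $\varphi^x$ converges in $X$ to $e_0^{-1}\omega_{\mathbf r}^0(x)$, and therefore $e_0^{-1}\omega_{\mathbf r}^0(x)\in\omega^{\mathbf r}(x)$. (ii) If $X$ is Hausdorff, then $\omega^{\mathbf r}(x)=\{e_0^{-1}\omega_{\mathbf r}^0(x)\}$ for every $x\in X$, and $C(X)=P(X)=\overline{\Omega^{\mathbf r}(X)}$.
   Context: Exterior spaces: an exterior space is a topological space $X$ together with a nonempty family $\varepsilon(X)$ of open subsets (an externology; its members are called exterior open subsets) closed under finite intersections and such that if $E\in\varepsilon(X)$, $U$ is open and $E\subset U$, then $U\in\varepsilon(X)$. A map is exterior if it is continuous and preimages of exterior open subsets are exterior open; $\mathbf E$ is the resulting category. For an exterior space $X$ and a topological space $Y$, $X\bar\times Y$ is $X\times Y$ with the product topology and the externology of those open $E$ such that for each $y\in Y$ there are an open neighbourhood $U_y$ of $y$ and $T^y\in\varepsilon(X)$ with $T^y\times U_y\subset E$. $I=[0,1]$. $\mathbb R^{\mathbf r}$ is $\mathbb R$ with externology $\mathbf r=\{U \text{ open}: (n,+\infty)\subset U\text{ for some } n\in\mathbb N\}$. For an exterior space $M$, $M_{\mathbf t}$ is the underlying topological space and $M_{\mathbf d}$ the underlying set with the discrete topology. An $\mathbf r$-exterior flow is an exterior space $M$ with a flow $\varphi\colon\mathbb R\times M_{\mathbf t}\to M_{\mathbf t}$, $\varphi(t,x)=t\cdot x$ (a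 continuous action of the additive group $\mathbb R$) such that $\varphi\colon\mathbb R^{\mathbf r}\bar\times M_{\mathbf d}\to M$ is exterior and, for every $t\in\mathbb R$, $F_t\colon M\bar\times I\to M$, $F_t(x,s)=\varphi(ts,x)$, is exterior. Limit and end spaces: for a space $Y$, $\pi_0(Y)$ is the set of path-components with the quotient topology of $q_0\colon Y\to\pi_0(Y)$. $L(X)=\bigcap_{E\in\varepsilon(X)}E$ (subspace topology); $\check\pi_0(X)=\lim_{E\in\varepsilon(X)}\pi_0(E)$ (inverse limit topology), with projections $\eta_{0,E}\colon\check\pi_0(X)\to\pi_0(E)$; $e_0\colon L(X)\to\check\pi_0(X)$ sends $x$ to the family of path-components of $x$ in the sets $E$. Completion: $\check C_0(X)$ has underlying set the push-out $X\cup_{L(X)}\check\pi_0(X)$ of the inclusion $L(X)\to X$ and $e_0$, with canonical maps $p_0\colon X\to\check C_0(X)$, $\operatorname{in}_0\colon\check\pi_0(X)\to\check C_0(X)$. A subset $W$ is open iff (a) $p_0^{-1}(W)$ and $\operatorname{in}_0^{-1}(W)$ are open, and (b) for each $a\in\operatorname{in}_0^{-1}(W)$ there are $E\in\varepsilon(X)$ and an open $G\subset\pi_0(E)$ with $a\in\eta_{0,E}^{-1}(G)\subset\operatorname{in}_0^{-1}(W)$ and $q_0^{-1}(G)\subset p_0^{-1}(W)$. Its externology is $\{W_0(E): E\in\varepsilon(X)\}$ with $W_0(E)=p_0(E)\cup\operatorname{in}_0(\check\pi_0(X))$. $X$ is $\check C_0$-complete if $p_0\colon X\to\check C_0(X)$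 is an isomorphism in $\mathbf E$; in that case $e_0$ is bijective. Dynamics: $\varphi^x\colon\mathbb R\to X$, $\varphi^x(t)=t\cdot x$, is regarded as a net indexed by $\mathbb R$ with its usual order. For $x\in X$ and $E\in\varepsilon(X)$, $\omega_{\mathbf r}^0(x,E)$ is the unique path-component of $E$ containing $(n,+\infty)\cdot x$ for some $n$, and $\omega_{\mathbf r}^0(x)=(\omega_{\mathbf r}^0(x,E))_{E}\in\check\pi_0(X)$. $\omega^{\mathbf r}(x)=\bigcap_{t\ge0}\overline{[t,+\infty)\cdot x}$, $\Omega^{\mathbf r}(X)=\bigcup_x\omega^{\mathbf r}(x)$. $C(X)$ is the set of critical points ($t\cdot x=x$ for all $t$), $P(X)$ the set of periodic points ($r\cdot x=x$ for some $r\neq0$). *)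

theory Defs
  imports "HOL-Analysis.Analysis"
begin

section \<open>Exterior spaces\<close>

text \<open>A topology together with a family of exterior open sets, not yet subject to any axioms;
  see \<open>exterior_space\<close>.\<close>

record 'a ext_space =
  etop :: "'a topology"
  eopens :: "'a set set"

abbreviation points :: "'a ext_space \<Rightarrow> 'a set" where
  "points X \<equiv> topspace (etop X)"

definition exterior_space :: "'a ext_space \<Rightarrow> bool" where
  "exterior_space X \<longleftrightarrow>
     eopens X \<noteq> {} \<and>
     (\<forall>E\<in>eopens X. openin (etop X) E) \<and>
     (\<forall>E\<in>eopens X. \<forall>F\<in>eopens X. E \<inter> F \<in> eopens X) \<and>
     (\<forall>E\<in>eopens X. \<forall>U. openin (etop X) U \<and> E \<subseteq> U \<longrightarrow> U \<in> eopens X)"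

definition exterior_map :: "'a ext_space \<Rightarrow> 'b ext_space \<Rightarrow> ('a \<Rightarrow> 'b) \<Rightarrow> bool" where
  "exterior_map X Y f \<longleftrightarrow>
     continuous_map (etop X) (etop Y) f \<and>
     (\<forall>E\<in>eopens Y. {x \<in> points X. f x \<in> E} \<in> eopens X)"

definition exterior_iso :: "'a ext_space \<Rightarrow> 'b ext_space \<Rightarrow> ('a \<Rightarrow> 'b) \<Rightarrow> bool" where
  "exterior_iso X Y f \<longleftrightarrow>
     exterior_map X Y f \<and>
     (\<exists>g. exterior_map Y X g \<and>
          (\<forall>x\<in>points X. g (f x) = x) \<and> (\<forall>y\<in>points Y. f (g y) = y))"

definition bar_prod :: "'a ext_space \<Rightarrow> 'b topology \<Rightarrow> ('a \<times> 'b) ext_space" where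
  "bar_prod X Y =
     \<lparr> etop = prod_topology (etop X) Y,
       eopens = {E. openin (prod_topology (etop X) Y) E \<and>
                    (\<forall>y\<in>topspace Y. \<exists>U T. openin Y U \<and> y \<in> U \<and> T \<in> eopens X \<and> T \<times> U \<subseteq> E)} \<rparr>"

definition real_r :: "real ext_space" where
  "real_r = \<lparr> etop = euclideanreal, eopens = {U. open U \<and> (\<exists>n::nat. {real n<..} \<subseteq> U)} \<rparr>"


section \<open>Exterior flows\<close>

definition is_flow :: "'a topology \<Rightarrow> (real \<Rightarrow> 'a \<Rightarrow> 'a) \<Rightarrow> bool" where
  "is_flow M \<phi> \<longleftrightarrow>
     continuous_map (prod_topology euclideanreal M) M (\<lambda>(t, x). \<phi> t x) \<and>
     (\<forall>x\<in>topspace M. \<phi> 0 x = x) \<and>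
     (\<forall>s t. \<forall>x\<in>topspace M. \<phi> (s + t) x = \<phi> s (\<phi> t x))"

definition r_exterior_flow :: "'a ext_space \<Rightarrow> (real \<Rightarrow> 'a \<Rightarrow> 'a) \<Rightarrow> bool" where
  "r_exterior_flow M \<phi> \<longleftrightarrow>
     exterior_space M \<and> is_flow (etop M) \<phi> \<and>
     exterior_map (bar_prod real_r (discrete_topology (points M))) M (\<lambda>(t, x). \<phi> t x) \<and>
     (\<forall>t. exterior_map (bar_prod M (top_of_set {0..1::real})) M (\<lambda>(x, s). \<phi> (t * s) x))"


section \<open>Limit space and end space\<close>

text \<open>The space of path components, with the quotient topology of
  \<open>path_component_of_set Y\<close>.\<close>

definition pi0 :: "'a topology \<Rightarrow> 'a set topology" where
  "pi0 Y = topology (\<lambda>G. G \<subseteq> path_components_of Y \<and>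
                        openin Y {x \<in> topspace Y. path_component_of_set Y x \<in> G})"

definition limit_space :: "'a ext_space \<Rightarrow> 'a set" where
  "limit_space X = \<Inter> (eopens X)"

text \<open>The path components of \<open>E\<close>, a subset of the space \<open>X\<close>, and the map on path components
  induced by an inclusion of \<open>E\<close> into \<open>E'\<close>.\<close>

abbreviation comp_in :: "'a ext_space \<Rightarrow> 'a set \<Rightarrow> 'a \<Rightarrow> 'a set" where
  "comp_in X E \<equiv> path_component_of_set (subtopology (etop X) E)"

abbreviation pi0_in :: "'a ext_space \<Rightarrow> 'a set \<Rightarrow> 'a set topology" where
  "pi0_in X E \<equiv> pi0 (subtopology (etop X) E)"

definition bond :: "'a ext_space \<Rightarrow> 'a set \<Rightarrow> 'a set \<Rightarrow> 'a set" where
  "bond X E' C = (THE D. D \<in> path_components_of (subtopology (etop X) E') \<and> C \<subseteq> D)"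

text \<open>The inverse limit over the exterior open sets, directed by inclusion; the projection to the
  factor of \<open>E\<close> is evaluation at \<open>E\<close>.\<close>

definition end_space :: "'a ext_space \<Rightarrow> ('a set \<Rightarrow> 'a set) topology" where
  "end_space X =
     subtopology (product_topology (pi0_in X) (eopens X))
       {a. \<forall>E\<in>eopens X. \<forall>E'\<in>eopens X. E \<subseteq> E' \<longrightarrow> bond X E' (a E) = a E'}"

definition e0 :: "'a ext_space \<Rightarrow> 'a \<Rightarrow> ('a set \<Rightarrow> 'a set)" where
  "e0 X x = (\<lambda>E\<in>eopens X. comp_in X E x)"


section \<open>The completion\<close>

text \<open>The equivalence relation on a disjoint union generated by gluing \<open>x \<in> L\<close> to \<open>f x\<close>.\<close>

definition glue :: "'a set \<Rightarrow> ('a \<Rightarrow> 'b) \<Rightarrow> ('a + 'b) rel" where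
  "glue L f = ({(Inl x, Inr (f x)) | x. x \<in> L} \<union> {(Inr (f x), Inl x) | x. x \<in> L})\<^sup>*"

type_synonym 'a completion_pt = "('a + ('a set \<Rightarrow> 'a set)) set"

abbreviation C0_glue :: "'a ext_space \<Rightarrow> ('a + ('a set \<Rightarrow> 'a set)) rel" where
  "C0_glue X \<equiv> glue (limit_space X) (e0 X)"

definition C0_carrier :: "'a ext_space \<Rightarrow> 'a completion_pt set" where
  "C0_carrier X = (points X <+> topspace (end_space X)) // C0_glue X"

definition p0 :: "'a ext_space \<Rightarrow> 'a \<Rightarrow> 'a completion_pt" where
  "p0 X x = C0_glue X `` {Inl x}"

definition in0 :: "'a ext_space \<Rightarrow> ('a set \<Rightarrow> 'a set) \<Rightarrow> 'a completion_pt" where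
  "in0 X a = C0_glue X `` {Inr a}"

text \<open>The condition that links the two parts of an open set at an end \<open>a\<close>.\<close>

definition C0_near :: "'a ext_space \<Rightarrow> 'a completion_pt set \<Rightarrow> ('a set \<Rightarrow> 'a set) \<Rightarrow> bool" where
  "C0_near X W a \<longleftrightarrow>
     (\<exists>E\<in>eopens X. \<exists>G. openin (pi0_in X E) G \<and> a E \<in> G \<and>
        {b \<in> topspace (end_space X). b E \<in> G} \<subseteq> {b \<in> topspace (end_space X). in0 X b \<in> W} \<and>
        {x \<in> E. comp_in X E x \<in> G} \<subseteq> {x \<in> points X. p0 X x \<in> W})"

definition C0_open :: "'a ext_space \<Rightarrow> 'a completion_pt set \<Rightarrow> bool" where
  "C0_open X W \<longleftrightarrow>
     W \<subseteq> C0_carrier X \<and>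
     openin (etop X) {x \<in> points X. p0 X x \<in> W} \<and>
     openin (end_space X) {a \<in> topspace (end_space X). in0 X a \<in> W} \<and>
     (\<forall>a \<in> {a \<in> topspace (end_space X). in0 X a \<in> W}. C0_near X W a)"

definition C0 :: "'a ext_space \<Rightarrow> 'a completion_pt ext_space" where
  "C0 X = \<lparr> etop = topology (C0_open X),
            eopens = (\<lambda>E. p0 X ` E \<union> in0 X ` topspace (end_space X)) ` eopens X \<rparr>"

definition C0_complete :: "'a ext_space \<Rightarrow> bool" where
  "C0_complete X \<longleftrightarrow> exterior_iso X (C0 X) (p0 X)"


section \<open>Limit points of trajectories\<close>

definition omega0_at :: "'a ext_space \<Rightarrow> (real \<Rightarrow> 'a \<Rightarrow> 'a) \<Rightarrow> 'a \<Rightarrow> 'a set \<Rightarrow> 'a set" where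
  "omega0_at X \<phi> x E =
     (THE C. C \<in> path_components_of (subtopology (etop X) E) \<and>
             (\<exists>n::nat. (\<lambda>t. \<phi> t x) ` {real n<..} \<subseteq> C))"

definition omega0 :: "'a ext_space \<Rightarrow> (real \<Rightarrow> 'a \<Rightarrow> 'a) \<Rightarrow> 'a \<Rightarrow> ('a set \<Rightarrow> 'a set)" where
  "omega0 X \<phi> x = (\<lambda>E\<in>eopens X. omega0_at X \<phi> x E)"

text \<open>The inverse of \<open>e0 X\<close> makes sense on all of the end space when \<open>X\<close> is complete, by
  \<open>bij_betw_e0\<close> below; likewise \<open>omega0_at_ex1\<close> justifies the description in
  \<open>omega0_at\<close>.\<close>

definition e0_inv :: "'a ext_space \<Rightarrow> ('a set \<Rightarrow> 'a set) \<Rightarrow> 'a" where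
  "e0_inv X = the_inv_into (limit_space X) (e0 X)"

definition omega_limit :: "'a topology \<Rightarrow> (real \<Rightarrow> 'a \<Rightarrow> 'a) \<Rightarrow> 'a \<Rightarrow> 'a set" where
  "omega_limit M \<phi> x = (\<Inter>t\<in>{0..}. M closure_of ((\<lambda>s. \<phi> s x) ` {t..}))"

definition Omega_limit :: "'a topology \<Rightarrow> (real \<Rightarrow> 'a \<Rightarrow> 'a) \<Rightarrow> 'a set" where
  "Omega_limit M \<phi> = (\<Union>x\<in>topspace M. omega_limit M \<phi> x)"

definition critical_points :: "'a topology \<Rightarrow> (real \<Rightarrow> 'a \<Rightarrow> 'a) \<Rightarrow> 'a set" where
  "critical_points M \<phi> = {x \<in> topspace M. \<forall>t. \<phi> t x = x}"

definition periodic_points :: "'a topology \<Rightarrow> (real \<Rightarrow> 'a \<Rightarrow> 'a) \<Rightarrow> 'a set" where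
  "periodic_points M \<phi> = {x \<in> topspace M. \<exists>r. r \<noteq> 0 \<and> \<phi> r x = x}"


section \<open>Well-definedness\<close>

lemma exterior_spaceD:
  assumes "exterior_space X"
  shows "eopens X \<noteq> {}"
    and "E \<in> eopens X \<Longrightarrow> openin (etop X) E"
    and "E \<in> eopens X \<Longrightarrow> E \<subseteq> points X"
    and "E \<in> eopens X \<Longrightarrow> F \<in> eopens X \<Longrightarrow> E \<inter> F \<in> eopens X"
    and "E \<in> eopens X \<Longrightarrow> openin (etop X) U \<Longrightarrow> E \<subseteq> U \<Longrightarrow> U \<in> eopens X"
  using assms unfolding exterior_space_def by (meson openin_subset)+


subsection \<open>Path components and end space\<close>

lemma istopology_pi0:
  "istopology (\<lambda>G. G \<subseteq> path_components_of Y \<and>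
                  openin Y {x \<in> topspace Y. path_component_of_set Y x \<in> G})"
  unfolding istopology_def
proof (intro conjI allI impI; (elim conjE)?)
  fix G H
  assume "openin Y {x \<in> topspace Y. path_component_of_set Y x \<in> G}"
         "openin Y {x \<in> topspace Y. path_component_of_set Y x \<in> H}"
  then have "openin Y ({x \<in> topspace Y. path_component_of_set Y x \<in> G} \<inter>
                       {x \<in> topspace Y. path_component_of_set Y x \<in> H})"
    by (rule openin_Int)
  also have "\<dots> = {x \<in> topspace Y. path_component_of_set Y x \<in> G \<inter> H}"
    by blast
  finally (back_subst) show "openin Y \<dots>" .
next
  fix K assume K: "\<forall>G\<in>K. G \<subseteq> path_components_of Y \<and>
                     openin Y {x \<in> topspace Y. path_component_of_set Y x \<in> G}"
  then show "\<Union>K \<subseteq> path_components_of Y" by blast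
  have "openin Y (\<Union>G\<in>K. {x \<in> topspace Y. path_component_of_set Y x \<in> G})"
    using K by (intro openin_Union) blast
  also have "\<dots> = {x \<in> topspace Y. path_component_of_set Y x \<in> \<Union>K}"
    by blast
  finally (back_subst) show "openin Y \<dots>" .
qed blast

lemma openin_pi0:
  "openin (pi0 Y) G \<longleftrightarrow>
     G \<subseteq> path_components_of Y \<and> openin Y {x \<in> topspace Y. path_component_of_set Y x \<in> G}"
  unfolding pi0_def topology_inverse'[OF istopology_pi0] ..

lemma topspace_pi0 [simp]: "topspace (pi0 Y) = path_components_of Y"
proof
  show "topspace (pi0 Y) \<subseteq> path_components_of Y"
    by (auto simp: topspace_def openin_pi0)
  have "{x \<in> topspace Y. path_component_of_set Y x \<in> path_components_of Y} = topspace Y"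
    by (auto simp: path_component_in_path_components_of)
  then show "path_components_of Y \<subseteq> topspace (pi0 Y)"
    by (metis openin_pi0 openin_subset openin_topspace order_refl)
qed

lemma path_components_of_eqI:
  assumes "C \<in> path_components_of Y" "D \<in> path_components_of Y" "x \<in> C" "x \<in> D"
  shows "C = D"
  using assms pairwise_disjoint_path_components_of[of Y]
  by (meson disjnt_iff pairwiseD)

lemma bond_comp_in:
  assumes "exterior_space X" "E \<in> eopens X" "E' \<in> eopens X" "E \<subseteq> E'" "x \<in> E"
  shows "bond X E' (comp_in X E x) = comp_in X E' x"
proof -
  have sub: "E' \<subseteq> points X"
    using assms exterior_spaceD(3) by blast
  have x: "x \<in> topspace (subtopology (etop X) E)" "x \<in> topspace (subtopology (etop X) E')"
    using assms sub by auto
  show ?thesis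
    unfolding bond_def
  proof (rule the_equality, intro conjI)
    show "comp_in X E' x \<in> path_components_of (subtopology (etop X) E')"
      using x by (simp add: path_component_in_path_components_of)
    show "comp_in X E x \<subseteq> comp_in X E' x"
      using assms(4) by (auto intro: path_component_of_mono)
    fix D assume "D \<in> path_components_of (subtopology (etop X) E') \<and> comp_in X E x \<subseteq> D"
    moreover have "x \<in> comp_in X E x" "x \<in> comp_in X E' x"
      using x by (simp_all add: path_component_of_refl)
    ultimately show "D = comp_in X E' x"
      using path_components_of_eqI x(2) path_component_in_path_components_of by (metis subsetD)
  qed
qed

lemma topspace_end_space:
  "topspace (end_space X) =
     {a \<in> PiE (eopens X) (\<lambda>E. path_components_of (subtopology (etop X) E)).
        \<forall>E\<in>eopens X. \<forall>E'\<in>eopens X. E \<subseteq> E' \<longrightarrow> bond X E' (a E) = a E'}"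
  by (simp add: end_space_def Int_def)

lemma e0_in_end_space:
  assumes "exterior_space X" "x \<in> limit_space X"
  shows "e0 X x \<in> topspace (end_space X)"
proof -
  have "x \<in> E" "x \<in> points X" if "E \<in> eopens X" for E
    using assms that exterior_spaceD(3)[OF assms(1) that] by (auto simp: limit_space_def)
  then show ?thesis
    using assms(1) unfolding topspace_end_space
    by (simp add: e0_def path_component_in_path_components_of bond_comp_in)
qed


subsection \<open>The push-out\<close>

lemma glue_iff:
  "(u, v) \<in> glue L f \<longleftrightarrow>
     case_sum (\<lambda>x. if x \<in> L then Inr (f x) else Inl x) Inr u =
     case_sum (\<lambda>x. if x \<in> L then Inr (f x) else Inl x) Inr v"
  (is "_ \<longleftrightarrow> ?n u = ?n v")
proof -
  let ?R = "{(Inl x, Inr (f x)) | x. x \<in> L} \<union> {(Inr (f x), Inl x) | x. x \<in> L}"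
  have "sym ?R" by (rule symI) blast
  then have sym: "sym (glue L f)" unfolding glue_def by (rule sym_rtrancl)
  have trans: "trans (glue L f)" unfolding glue_def by (rule trans_rtrancl)
  have norm: "(w, ?n w) \<in> glue L f" for w
  proof (cases w)
    case (Inl x)
    then show ?thesis
      by (cases "x \<in> L") (simp_all add: glue_def r_into_rtrancl)
  qed (simp add: glue_def)
  show ?thesis
  proof
    assume "(u, v) \<in> glue L f"
    then show "?n u = ?n v"
      unfolding glue_def
    proof (induction rule: rtrancl_induct)
      case (step y z)
      from step(2) have "?n y = ?n z" by fastforce
      with step(3) show ?case by simp
    qed simp
  next
    assume eq: "?n u = ?n v"
    show "(u, v) \<in> glue L f"
      by (rule transD[OF trans norm[of u, unfolded eq] symD[OF sym norm]])
  qed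
qed

lemma equiv_glue: "equiv UNIV (glue L f)"
  by (intro equivI refl_onI symI transI) (simp_all only: glue_iff subset_UNIV UNIV_I UNIV_Times_UNIV)

lemma p0_eq_iff: "p0 X x = p0 X y \<longleftrightarrow>
    x = y \<or> x \<in> limit_space X \<and> y \<in> limit_space X \<and> e0 X x = e0 X y"
  unfolding p0_def by (subst eq_equiv_class_iff[OF equiv_glue]) (auto simp: glue_iff)

lemma in0_eq_iff: "in0 X a = in0 X b \<longleftrightarrow> a = b"
  unfolding in0_def by (subst eq_equiv_class_iff[OF equiv_glue]) (auto simp: glue_iff)

lemma p0_eq_in0_iff: "p0 X x = in0 X a \<longleftrightarrow> x \<in> limit_space X \<and> e0 X x = a"
  unfolding p0_def in0_def by (subst eq_equiv_class_iff[OF equiv_glue]) (auto simp: glue_iff)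

lemma C0_carrier_eq: "C0_carrier X = p0 X ` points X \<union> in0 X ` topspace (end_space X)"
  by (auto simp: C0_carrier_def quotient_def p0_def in0_def)


subsection \<open>The completion is an exterior space\<close>

lemma C0_near_mono: "C0_near X V a \<Longrightarrow> V \<subseteq> W \<Longrightarrow> C0_near X W a"
  unfolding C0_near_def by (elim bexE exE conjE, intro bexI exI conjI) (assumption | blast)+

lemma C0_near_Int:
  assumes X: "exterior_space X" and a: "a \<in> topspace (end_space X)"
    and V: "C0_near X V a" and W: "C0_near X W a"
  shows "C0_near X (V \<inter> W) a"
proof -
  obtain E1 G1 where 1: "E1 \<in> eopens X" "openin (pi0_in X E1) G1" "a E1 \<in> G1"
      "{b \<in> topspace (end_space X). b E1 \<in> G1} \<subseteq> {b \<in> topspace (end_space X). in0 X b \<in> V}"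
      "{x \<in> E1. comp_in X E1 x \<in> G1} \<subseteq> {x \<in> points X. p0 X x \<in> V}"
    using V unfolding C0_near_def by (elim bexE exE conjE)
  obtain E2 G2 where 2: "E2 \<in> eopens X" "openin (pi0_in X E2) G2" "a E2 \<in> G2"
      "{b \<in> topspace (end_space X). b E2 \<in> G2} \<subseteq> {b \<in> topspace (end_space X). in0 X b \<in> W}"
      "{x \<in> E2. comp_in X E2 x \<in> G2} \<subseteq> {x \<in> points X. p0 X x \<in> W}"
    using W unfolding C0_near_def by (elim bexE exE conjE)
  define E where "E = E1 \<inter> E2"
  have E: "E \<in> eopens X" "E \<subseteq> E1" "E \<subseteq> E2"
    using exterior_spaceD(4)[OF X 1(1) 2(1)] by (auto simp: E_def)
  note sub = exterior_spaceD(3)[OF X 1(1)] exterior_spaceD(3)[OF X 2(1)]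
    exterior_spaceD(3)[OF X E(1)]
  note op = exterior_spaceD(2)[OF X 1(1)] exterior_spaceD(2)[OF X 2(1)]
    exterior_spaceD(2)[OF X E(1)]
  define G where "G = {C \<in> path_components_of (subtopology (etop X) E).
                         bond X E1 C \<in> G1 \<and> bond X E2 C \<in> G2}"
  have comp_G: "comp_in X E x \<in> G \<longleftrightarrow> comp_in X E1 x \<in> G1 \<and> comp_in X E2 x \<in> G2"
    if "x \<in> E" for x
  proof -
    have "x \<in> topspace (subtopology (etop X) E)" using that sub by auto
    then have "comp_in X E x \<in> path_components_of (subtopology (etop X) E)"
      by (simp only: path_component_in_path_components_of)
    then show ?thesis
      by (simp only: G_def mem_Collect_eq simp_thms
            bond_comp_in[OF X E(1) 1(1) E(2) that] bond_comp_in[OF X E(1) 2(1) E(3) that])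
  qed
  have bG: "b E \<in> G \<longleftrightarrow> b E1 \<in> G1 \<and> b E2 \<in> G2" if "b \<in> topspace (end_space X)" for b
  proof -
    have "b E \<in> path_components_of (subtopology (etop X) E)"
      "bond X E1 (b E) = b E1" "bond X E2 (b E) = b E2"
      using that E 1(1) 2(1) unfolding topspace_end_space by blast+
    then show ?thesis by (simp only: G_def mem_Collect_eq simp_thms)
  qed
  have pre: "openin (etop X) {x \<in> F. comp_in X F x \<in> H}"
    if "openin (pi0_in X F) H" "openin (etop X) F" "F \<subseteq> points X" for F H
  proof -
    have "topspace (subtopology (etop X) F) = F" using that(3) by auto
    then show ?thesis
      using that(1) unfolding openin_pi0 openin_open_subtopology[OF that(2)] by auto
  qed
  have "openin (etop X) ({x \<in> E1. comp_in X E1 x \<in> G1} \<inter> {x \<in> E2. comp_in X E2 x \<in> G2})"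
    using pre 1(2) 2(2) op sub by (intro openin_Int) blast+
  also have "\<dots> = {x \<in> topspace (subtopology (etop X) E). comp_in X E x \<in> G}"
    using comp_G sub by (auto simp: E_def)
  finally have "openin (pi0_in X E) G"
    unfolding openin_pi0 openin_open_subtopology[OF op(3)] by (auto simp: G_def)
  moreover have "a E \<in> G" using bG[OF a] 1(3) 2(3) by simp
  moreover have "{b \<in> topspace (end_space X). b E \<in> G} \<subseteq>
      {b \<in> topspace (end_space X). in0 X b \<in> V \<inter> W}"
    using bG 1(4) 2(4) by blast
  moreover have "{x \<in> E. comp_in X E x \<in> G} \<subseteq> {x \<in> points X. p0 X x \<in> V \<inter> W}"
    using comp_G 1(5) 2(5) E(2,3) by blast
  ultimately show ?thesis
    unfolding C0_near_def by (intro bexI[OF _ E(1)] exI[of _ G] conjI)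
qed

lemma istopology_C0_open:
  assumes X: "exterior_space X"
  shows "istopology (C0_open X)"
  unfolding istopology_def
proof (intro conjI allI impI)
  fix V W assume V: "C0_open X V" and W: "C0_open X W"
  have eq: "{x \<in> points X. p0 X x \<in> V \<inter> W} =
              {x \<in> points X. p0 X x \<in> V} \<inter> {x \<in> points X. p0 X x \<in> W}"
           "{a \<in> topspace (end_space X). in0 X a \<in> V \<inter> W} =
              {a \<in> topspace (end_space X). in0 X a \<in> V} \<inter>
              {a \<in> topspace (end_space X). in0 X a \<in> W}"
    by blast+
  show "C0_open X (V \<inter> W)"
    using V W C0_near_Int[OF X] unfolding C0_open_def eq
    by (intro conjI openin_Int ballI) blast+
next
  fix K assume K: "\<forall>W\<in>K. C0_open X W"
  have eq: "{x \<in> points X. p0 X x \<in> \<Union>K} = (\<Union>W\<in>K. {x \<in> points X. p0 X x \<in> W})"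
           "{a \<in> topspace (end_space X). in0 X a \<in> \<Union>K} =
              (\<Union>W\<in>K. {a \<in> topspace (end_space X). in0 X a \<in> W})"
    by blast+
  show "C0_open X (\<Union>K)"
    unfolding C0_open_def eq
  proof (intro conjI ballI openin_Union)
    fix a assume "a \<in> (\<Union>W\<in>K. {a \<in> topspace (end_space X). in0 X a \<in> W})"
    then obtain W where "W \<in> K" "a \<in> {a \<in> topspace (end_space X). in0 X a \<in> W}" by blast
    moreover from this have "C0_near X W a" using K unfolding C0_open_def by blast
    ultimately show "C0_near X (\<Union>K) a" by (blast intro: C0_near_mono)
  qed (use K in \<open>unfold C0_open_def, blast+\<close>)
qed

lemma openin_C0: "exterior_space X \<Longrightarrow> openin (etop (C0 X)) W \<longleftrightarrow> C0_open X W"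
  by (simp add: C0_def topology_inverse' istopology_C0_open)

lemma C0_open_eopens:
  assumes X: "exterior_space X" and E: "E \<in> eopens X"
  shows "C0_open X (p0 X ` E \<union> in0 X ` topspace (end_space X))" (is "C0_open X ?W")
proof -
  have oE: "openin (etop X) E" and sub: "E \<subseteq> points X"
    using exterior_spaceD(2,3)[OF X E] by auto
  have L: "limit_space X \<subseteq> E" using E by (auto simp: limit_space_def)
  have pE: "{x \<in> points X. p0 X x \<in> ?W} = E"
    using sub L by (auto simp: p0_eq_iff p0_eq_in0_iff)
  have "C0_near X ?W a" if "a \<in> topspace (end_space X)" for a
    unfolding C0_near_def
  proof (intro bexI[OF _ E] exI[of _ "path_components_of (subtopology (etop X) E)"] conjI)
    show "openin (pi0_in X E) (path_components_of (subtopology (etop X) E))"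
      by (metis openin_topspace topspace_pi0)
    show "a E \<in> path_components_of (subtopology (etop X) E)"
      using that E unfolding topspace_end_space by blast
  qed (use pE in blast)+
  moreover have "{a \<in> topspace (end_space X). in0 X a \<in> ?W} = topspace (end_space X)"
    by blast
  ultimately show ?thesis
    using oE sub unfolding C0_open_def pE C0_carrier_eq by (intro conjI ballI) auto
qed

lemma points_C0: "exterior_space X \<Longrightarrow> points (C0 X) = C0_carrier X"
proof
  assume X: "exterior_space X"
  then show "points (C0 X) \<subseteq> C0_carrier X"
    by (auto simp: topspace_def openin_C0 C0_open_def)
  have "points X \<in> eopens X"
    using exterior_spaceD(1,3,5)[OF X] by (meson all_not_in_conv openin_topspace)
  then show "C0_carrier X \<subseteq> points (C0 X)"
    using C0_open_eopens[OF X] openin_C0[OF X] unfolding C0_carrier_eq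
    by (metis openin_subset)
qed

lemma exterior_space_C0:
  assumes X: "exterior_space X"
  shows "exterior_space (C0 X)"
proof -
  let ?Z = "in0 X ` topspace (end_space X)"
  let ?W = "\<lambda>E. p0 X ` E \<union> ?Z"
  have eo: "eopens (C0 X) = ?W ` eopens X" by (simp add: C0_def)
  have "\<exists>G\<in>eopens X. ?W E \<inter> ?W F = ?W G" if E: "E \<in> eopens X" and F: "F \<in> eopens X" for E F
  proof
    show "E \<inter> F \<in> eopens X" by (rule exterior_spaceD(4)[OF X E F])
    have "p0 X x \<in> ?Z" if "x \<in> limit_space X" for x
      using that e0_in_end_space[OF X that] by (auto simp: p0_eq_in0_iff intro!: image_eqI)
    then show "?W E \<inter> ?W F = ?W (E \<inter> F)"
      by (auto simp: p0_eq_iff)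
  qed
  moreover have "\<exists>G\<in>eopens X. U = ?W G" if E: "E \<in> eopens X" and U: "C0_open X U" "?W E \<subseteq> U" for E U
  proof
    let ?G = "{x \<in> points X. p0 X x \<in> U}"
    have "E \<subseteq> points X" by (rule exterior_spaceD(3)[OF X E])
    then have "E \<subseteq> ?G" using U(2) by auto
    moreover have "openin (etop X) ?G" using U(1) by (simp add: C0_open_def)
    ultimately show "?G \<in> eopens X" using exterior_spaceD(5)[OF X E] by blast
    have "U \<subseteq> C0_carrier X" using U(1) by (simp add: C0_open_def)
    then show "U = ?W ?G" using U(2) by (auto simp: C0_carrier_eq)
  qed
  moreover have "eopens X \<noteq> {}" by (rule exterior_spaceD(1)[OF X])
  ultimately show ?thesis
    unfolding exterior_space_def openin_C0[OF X] eo
    using C0_open_eopens[OF X] by (simp add: image_iff)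
qed


subsection \<open>Completeness and limits of trajectories\<close>

lemma bij_betw_e0:
  assumes X: "exterior_space X" and c: "C0_complete X"
  shows "bij_betw (e0 X) (limit_space X) (topspace (end_space X))"
proof -
  obtain g where g: "\<forall>x\<in>points X. g (p0 X x) = x" "\<forall>y\<in>points (C0 X). p0 X (g y) = y"
    using c by (auto simp: C0_complete_def exterior_iso_def)
  have L: "limit_space X \<subseteq> points X"
    using exterior_spaceD(1,3)[OF X] unfolding limit_space_def by blast
  have "inj_on (e0 X) (limit_space X)"
    using g(1) L by (intro inj_onI) (metis p0_eq_iff subsetD)
  moreover have "a \<in> e0 X ` limit_space X" if "a \<in> topspace (end_space X)" for a
  proof -
    have "p0 X (g (in0 X a)) = in0 X a"
      using g(2) that by (simp add: points_C0[OF X] C0_carrier_eq)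
    then show ?thesis unfolding p0_eq_in0_iff by (metis image_eqI)
  qed
  ultimately show ?thesis
    using e0_in_end_space[OF X] by (auto simp: bij_betw_def)
qed

lemma omega0_at_ex1:
  assumes F: "r_exterior_flow X \<phi>" and x: "x \<in> points X" and E: "E \<in> eopens X"
  shows "\<exists>!C. C \<in> path_components_of (subtopology (etop X) E) \<and>
              (\<exists>n::nat. (\<lambda>t. \<phi> t x) ` {real n<..} \<subseteq> C)"
proof -
  let ?P = "bar_prod real_r (discrete_topology (points X))"
  have "{z \<in> points ?P. (\<lambda>(t, x). \<phi> t x) z \<in> E} \<in> eopens ?P"
    using F E unfolding r_exterior_flow_def exterior_map_def by blast
  then obtain T U where T: "T \<in> eopens real_r" "x \<in> U"
      "T \<times> U \<subseteq> {z \<in> points ?P. (\<lambda>(t, x). \<phi> t x) z \<in> E}"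
    using x by (auto simp: bar_prod_def)
  then obtain n :: nat where n: "{real n<..} \<subseteq> T" by (auto simp: real_r_def)
  have inE: "(\<lambda>t. \<phi> t x) ` {real n<..} \<subseteq> E" 
  proof (rule image_subsetI)
    fix t assume "t \<in> {real n<..}"
    then have "(t, x) \<in> T \<times> U" using n T(2) by blast
    then show "\<phi> t x \<in> E" using T(3) by fastforce
  qed
  have "continuous_map euclideanreal (etop X) ((\<lambda>(t, x). \<phi> t x) \<circ> (\<lambda>t. (t, x)))"
    using F x by (intro continuous_map_compose[of _ "prod_topology euclideanreal (etop X)"])
      (auto simp: r_exterior_flow_def is_flow_def continuous_map_pairwise o_def)
  then have cont: "continuous_map euclideanreal (etop X) (\<lambda>t. \<phi> t x)" by (simp add: o_def)
  have "path_connectedin euclideanreal {real n<..}"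
    by (simp add: path_connectedin_iff_path_connected_real is_interval_path_connected)
  then have "path_connectedin (etop X) ((\<lambda>t. \<phi> t x) ` {real n<..})"
    using cont path_connectedin_continuous_map_image by blast
  then have pc: "path_connectedin (subtopology (etop X) E) ((\<lambda>t. \<phi> t x) ` {real n<..})"
    using inE by (simp add: path_connectedin_subtopology)
  let ?y = "\<phi> (real n + 1) x" and ?C = "comp_in X E (\<phi> (real n + 1) x)"
  have y: "?y \<in> (\<lambda>t. \<phi> t x) ` {real n<..}" by auto
  have "?C \<in> path_components_of (subtopology (etop X) E)"
    using y pc path_connectedin_subset_topspace path_component_in_path_components_of
    by (metis subsetD)
  moreover have "(\<lambda>t. \<phi> t x) ` {real n<..} \<subseteq> ?C"
    by (rule path_component_of_maximal[OF pc y])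
  moreover have "C = D"
    if "C \<in> path_components_of (subtopology (etop X) E)" "(\<lambda>t. \<phi> t x) ` {real k<..} \<subseteq> C"
       "D \<in> path_components_of (subtopology (etop X) E)" "(\<lambda>t. \<phi> t x) ` {real l<..} \<subseteq> D" for C D k l
  proof (rule path_components_of_eqI[OF that(1,3)])
    show "\<phi> (max (real k) (real l) + 1) x \<in> C" "\<phi> (max (real k) (real l) + 1) x \<in> D"
      using that(2,4) by auto
  qed
  ultimately show ?thesis
    by (intro ex1I[of _ ?C]) (assumption | elim conjE exE | intro conjI exI)+
qed

lemma omega0_in_end_space:
  assumes F: "r_exterior_flow X \<phi>" and x: "x \<in> points X"
  shows "omega0 X \<phi> x \<in> topspace (end_space X)"
proof -
  have X: "exterior_space X" using F by (simp add: r_exterior_flow_def)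
  have w: "omega0_at X \<phi> x E \<in> path_components_of (subtopology (etop X) E)"
          "\<exists>n::nat. (\<lambda>t. \<phi> t x) ` {real n<..} \<subseteq> omega0_at X \<phi> x E" if "E \<in> eopens X" for E
    using theI'[OF omega0_at_ex1[OF F x that]] by (simp_all add: omega0_at_def)
  have "bond X E' (omega0_at X \<phi> x E) = omega0_at X \<phi> x E'"
    if E: "E \<in> eopens X" "E' \<in> eopens X" "E \<subseteq> E'" for E E'
  proof -
    obtain n m :: nat where nm: "(\<lambda>t. \<phi> t x) ` {real n<..} \<subseteq> omega0_at X \<phi> x E"
        "(\<lambda>t. \<phi> t x) ` {real m<..} \<subseteq> omega0_at X \<phi> x E'"
      using w(2) E by meson
    let ?y = "\<phi> (max (real n) (real m) + 1) x"
    have y: "?y \<in> omega0_at X \<phi> x E" "?y \<in> omega0_at X \<phi> x E'" using nm by auto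
    then have yt: "?y \<in> E" "?y \<in> topspace (subtopology (etop X) E)"
        "?y \<in> topspace (subtopology (etop X) E')"
      using path_components_of_subset[OF w(1)[OF E(1)]] path_components_of_subset[OF w(1)[OF E(2)]]
      by auto
    have "omega0_at X \<phi> x E = comp_in X E ?y" "omega0_at X \<phi> x E' = comp_in X E' ?y"
      using path_components_of_eqI[OF w(1)[OF E(1)] _ y(1)]
        path_components_of_eqI[OF w(1)[OF E(2)] _ y(2)] yt
      by (simp_all only: path_component_in_path_components_of mem_Collect_eq path_component_of_refl)
    then show ?thesis using bond_comp_in[OF X E yt(1)] by simp
  qed
  then show ?thesis
    using w(1) unfolding topspace_end_space omega0_def by simp
qed

end

theory Submission
  imports Defs
begin

text \<open>Completeness says that the topology of \<open>X\<close> is the one of its completion, and in the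
  completion every neighbourhood of an end \<open>a\<close> contains, by the condition linking the two parts of an
  open set, the image of the whole path component \<open>a E\<close> of some exterior open set \<open>E\<close>. Hence a point \<open>y\<close> of the
  limit space has arbitrarily small path components in exterior open sets
  (\<open>C0_complete_small_component\<close>). A trajectory eventually stays in the component of \<open>E\<close> that its
  end \<open>omega0\<close> selects, so it converges to the point of the limit space representing that end
  (\<open>limitin_e0_inv_omega0\<close>).

  The rest uses only that every trajectory of a flow on a Hausdorff space converges. The limit is
  then the only cluster point of the trajectory; it is critical, since shifting time does not change
  the limit; and a periodic trajectory, visiting each of its points at arbitrarily late times, is
  constant. So the union of all \<open>\<omega>\<close>-limits consists of critical points and contains all of them, and
  the set of critical points is closed.\<close>

section \<open>Convergent trajectories of a flow\<close>

lemma is_flow_continuous_space: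
  assumes "is_flow M \<phi>"
  shows "continuous_map M M (\<phi> t)"
proof -
  have "continuous_map M M ((\<lambda>(t, x). \<phi> t x) \<circ> (\<lambda>x. (t, x)))"
    using assms by (intro continuous_map_compose[of _ "prod_topology euclideanreal M"])
      (auto simp: is_flow_def continuous_map_pairwise o_def)
  then show ?thesis by (simp add: o_def)
qed

lemma limitin_in_omega_limit:
  assumes lim: "limitin M (\<lambda>t. \<phi> t x) y at_top"
  shows "y \<in> omega_limit M \<phi> x"
  unfolding omega_limit_def
proof
  fix s :: real
  show "y \<in> M closure_of ((\<lambda>t. \<phi> t x) ` {s..})"
    unfolding in_closure_of
  proof (intro conjI allI impI)
    show "y \<in> topspace M" by (rule limitin_topspace[OF lim])
    fix V assume V: "y \<in> V \<and> openin M V"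
    then have "eventually (\<lambda>t. \<phi> t x \<in> V) at_top" using lim by (auto simp: limitin_def)
    then have "eventually (\<lambda>t. \<phi> t x \<in> V \<and> s \<le> t) at_top"
      using eventually_ge_at_top by (rule eventually_conj)
    then obtain t where "\<phi> t x \<in> V" "s \<le> t"
      using eventually_happens[of _ "at_top :: real filter"] by auto
    then show "\<exists>z. z \<in> (\<lambda>t. \<phi> t x) ` {s..} \<and> z \<in> V" by auto
  qed
qed

lemma omega_limit_Hausdorff_eq:
  assumes H: "Hausdorff_space M" and lim: "limitin M (\<lambda>t. \<phi> t x) y at_top"
  shows "omega_limit M \<phi> x = {y}"
proof -
  have "z = y" if z: "z \<in> omega_limit M \<phi> x" for z
  proof (rule ccontr)
    assume "z \<noteq> y"
    have cl: "z \<in> M closure_of ((\<lambda>t. \<phi> t x) ` {s..})" if "s \<ge> 0" for s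
      using z that by (auto simp: omega_limit_def)
    then have "z \<in> topspace M" unfolding in_closure_of by blast
    then obtain U V where UV: "openin M U" "openin M V" "z \<in> U" "y \<in> V" "disjnt U V"
      using H \<open>z \<noteq> y\<close> limitin_topspace[OF lim] unfolding Hausdorff_space_def by metis
    then have "eventually (\<lambda>t. \<phi> t x \<in> V) at_top" using lim by (auto simp: limitin_def)
    then obtain s where s: "\<And>t. t \<ge> s \<Longrightarrow> \<phi> t x \<in> V" by (auto simp: eventually_at_top_linorder)
    have "\<exists>t\<ge>max s 0. \<phi> t x \<in> U"
      using cl[of "max s 0"] UV(1,3) unfolding in_closure_of by force
    then show False using s UV(5) by (auto simp: disjnt_iff)
  qed
  then show ?thesis using limitin_in_omega_limit[where \<phi> = \<phi> and x = x, OF lim] by blast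
qed

text \<open>Translating time by \<open>s\<close> turns the trajectory of \<open>x\<close> into that of \<open>\<phi> s x\<close>, with the
  same limit, while continuity of \<open>\<phi> s\<close> moves the limit \<open>y\<close> to \<open>\<phi> s y\<close>.\<close>

lemma limit_of_trajectory_critical:
  assumes H: "Hausdorff_space M" and F: "is_flow M \<phi>" and x: "x \<in> topspace M"
    and lim: "limitin M (\<lambda>t. \<phi> t x) y at_top"
  shows "y \<in> critical_points M \<phi>"
proof -
  have "\<phi> s y = y" for s
  proof (rule limitin_Hausdorff_unique)
    have "limitin M (\<phi> s \<circ> (\<lambda>t. \<phi> t x)) (\<phi> s y) at_top"
      by (rule continuous_map_limit[OF is_flow_continuous_space[OF F] lim])
    also have "\<phi> s \<circ> (\<lambda>t. \<phi> t x) = (\<lambda>t. \<phi> (s + t) x)"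
      using F x by (auto simp: is_flow_def)
    finally show "limitin M (\<lambda>t. \<phi> (s + t) x) (\<phi> s y) at_top" .
    have "filterlim (\<lambda>t. s + t) at_top at_top"
      by (rule filterlim_tendsto_add_at_top[OF tendsto_const filterlim_ident])
    then show "limitin M (\<lambda>t. \<phi> (s + t) x) y at_top"
      using lim by (auto simp: limitin_def dest: eventually_compose_filterlim)
  qed (use H in auto)
  then show ?thesis using limitin_topspace[OF lim] by (simp add: critical_points_def)
qed

text \<open>Along the multiples of the absolute value of a period, which tend to infinity, the
  trajectory has the constant value \<open>x\<close>.\<close>

lemma periodic_convergent_trajectory_limit:
  assumes H: "Hausdorff_space M" and F: "is_flow M \<phi>" and x: "x \<in> periodic_points M \<phi>"
    and lim: "limitin M (\<lambda>t. \<phi> t x) y at_top"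
  shows "y = x"
proof -
  obtain r where r: "r \<noteq> 0" "\<phi> r x = x" and xM: "x \<in> topspace M"
    using x by (auto simp: periodic_points_def)
  have add: "\<phi> (s + t) x = \<phi> s (\<phi> t x)" and zero: "\<phi> 0 x = x" for s t
    using F xM by (auto simp: is_flow_def)
  have "\<phi> (- r) x = x" using add[of "- r" r] r(2) zero by simp
  then have abs: "\<phi> \<bar>r\<bar> x = x" using r(2) by (simp add: abs_if)
  have mult: "\<phi> (real n * \<bar>r\<bar>) x = x" for n
  proof (induction n)
    case (Suc n)
    then show ?case using add[of "real n * \<bar>r\<bar>" "\<bar>r\<bar>"] abs by (simp add: algebra_simps)
  qed (simp add: zero)
  have "filterlim (\<lambda>n. real n * \<bar>r\<bar>) at_top sequentially"
    by (rule filterlim_at_top_mult_tendsto_pos[OF tendsto_const _ filterlim_real_sequentially])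
      (use r(1) in simp)
  then have "limitin M (\<lambda>n. \<phi> (real n * \<bar>r\<bar>) x) y sequentially"
    using lim by (auto simp: limitin_def dest: eventually_compose_filterlim)
  then show ?thesis
    using limitin_const_iff[OF Hausdorff_imp_t1_space[OF H] trivial_limit_sequentially]
    by (simp add: mult)
qed

lemma closedin_critical_points:
  assumes H: "Hausdorff_space M" and F: "is_flow M \<phi>"
  shows "closedin M (critical_points M \<phi>)"
proof -
  have "critical_points M \<phi> = (\<Inter>t. {x \<in> topspace M. \<phi> t x = x})"
    by (auto simp: critical_points_def)
  moreover have "closedin M {x \<in> topspace M. \<phi> t x = x}" for t
    by (rule closedin_continuous_maps_eq[OF H is_flow_continuous_space[OF F] continuous_map_id[unfolded id_def]])
  ultimately show ?thesis by auto
qed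

lemma convergent_flow_Hausdorff:
  assumes H: "Hausdorff_space M" and F: "is_flow M \<phi>"
    and lim: "\<And>x. x \<in> topspace M \<Longrightarrow> limitin M (\<lambda>t. \<phi> t x) (l x) at_top"
  shows "critical_points M \<phi> = periodic_points M \<phi>"
    and "critical_points M \<phi> = M closure_of Omega_limit M \<phi>"
proof -
  have omega: "omega_limit M \<phi> x = {l x}" if "x \<in> topspace M" for x
    using omega_limit_Hausdorff_eq[where \<phi> = \<phi> and x = x, OF H lim[OF that]] .
  have per: "l x = x" if "x \<in> periodic_points M \<phi>" for x
    using periodic_convergent_trajectory_limit[OF H F that lim] that
    by (simp add: periodic_points_def)
  have crit: "l x \<in> critical_points M \<phi>" if "x \<in> topspace M" for x
    using limit_of_trajectory_critical[OF H F that lim[OF that]] .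
  have CP: "critical_points M \<phi> \<subseteq> periodic_points M \<phi>"
    by (auto simp: critical_points_def periodic_points_def intro: exI[of _ 1])
  show eq: "critical_points M \<phi> = periodic_points M \<phi>"
  proof
    show "periodic_points M \<phi> \<subseteq> critical_points M \<phi>"
      using per crit by (metis (no_types, lifting) mem_Collect_eq periodic_points_def subsetI)
  qed (rule CP)
  have "Omega_limit M \<phi> = critical_points M \<phi>"
  proof
    show "Omega_limit M \<phi> \<subseteq> critical_points M \<phi>"
      using omega crit by (auto simp: Omega_limit_def)
    show "critical_points M \<phi> \<subseteq> Omega_limit M \<phi>"
    proof
      fix x assume x: "x \<in> critical_points M \<phi>"
      then have "x \<in> topspace M" "l x = x" using per eq by (auto simp: critical_points_def)
      then show "x \<in> Omega_limit M \<phi>" using omega by (force simp: Omega_limit_def)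
    qed
  qed
  then show "critical_points M \<phi> = M closure_of Omega_limit M \<phi>"
    using closedin_critical_points[OF H F] by (simp add: closure_of_closedin)
qed


section \<open>Convergence in a complete exterior space\<close>

text \<open>Transport \<open>V\<close> to the completion by the continuous inverse of \<open>p0 X\<close>. The point \<open>y\<close> is
  glued to its end there, and an open set of the completion around that end contains the image of a
  union of path components of some \<open>E\<close>, one of which is the component of \<open>y\<close>.\<close>

lemma C0_complete_small_component:
  assumes X: "exterior_space X" and c: "C0_complete X" and y: "y \<in> limit_space X"
    and V: "openin (etop X) V" "y \<in> V"
  shows "\<exists>E\<in>eopens X. comp_in X E y \<subseteq> V"
proof -
  obtain g where g: "continuous_map (etop (C0 X)) (etop X) g" "\<And>x. x \<in> points X \<Longrightarrow> g (p0 X x) = x"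
    using c by (auto simp: C0_complete_def exterior_iso_def exterior_map_def)
  define W where "W = {w \<in> points (C0 X). g w \<in> V}"
  have W: "C0_open X W"
    using openin_continuous_map_preimage[OF g(1) V(1)] openin_C0[OF X] by (simp add: W_def)
  have yX: "y \<in> points X" using V openin_subset by blast
  have "in0 X (e0 X y) = p0 X y" using y p0_eq_in0_iff by metis
  moreover have "p0 X y \<in> W"
    using yX V(2) g(2) by (simp add: W_def points_C0[OF X] C0_carrier_eq)
  ultimately have "C0_near X W (e0 X y)"
    using W e0_in_end_space[OF X y] by (auto simp: C0_open_def)
  then obtain E G where E: "E \<in> eopens X" "e0 X y E \<in> G"
      "{x \<in> E. comp_in X E x \<in> G} \<subseteq> {x \<in> points X. p0 X x \<in> W}"
    unfolding C0_near_def by blast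
  have "comp_in X E y \<subseteq> V"
  proof
    fix x assume x: "x \<in> comp_in X E y"
    then have "comp_in X E x = comp_in X E y"
      by (metis mem_Collect_eq path_component_of_eq path_component_of_equiv)
    moreover have "x \<in> E" using x path_component_of_subset_topspace by fastforce
    ultimately have "x \<in> points X" "p0 X x \<in> W" using E by (auto simp: e0_def)
    then show "x \<in> V" using g(2) by (simp add: W_def)
  qed
  then show ?thesis using E(1) by blast
qed

lemma limitin_e0_inv_omega0:
  assumes F: "r_exterior_flow X \<phi>" and c: "C0_complete X" and x: "x \<in> points X"
  shows "limitin (etop X) (\<lambda>t. \<phi> t x) (e0_inv X (omega0 X \<phi> x)) at_top"
proof -
  have X: "exterior_space X" using F by (simp add: r_exterior_flow_def)
  define y where "y = e0_inv X (omega0 X \<phi> x)"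
  note bij = bij_betw_e0[OF X c] and E0 = omega0_in_end_space[OF F x]
  have y: "y \<in> limit_space X"
    using bij E0 unfolding y_def e0_inv_def bij_betw_def by (metis order_refl the_inv_into_into)
  have e0y: "e0 X y = omega0 X \<phi> x"
    using f_the_inv_into_f_bij_betw[OF bij, of "omega0 X \<phi> x"] E0 by (simp add: y_def e0_inv_def)
  have yX: "y \<in> points X"
    using y exterior_spaceD(1,3)[OF X] unfolding limit_space_def by blast
  have "eventually (\<lambda>t. \<phi> t x \<in> V) at_top" if V: "openin (etop X) V" "y \<in> V" for V
  proof -
    obtain E where E: "E \<in> eopens X" "comp_in X E y \<subseteq> V"
      using C0_complete_small_component[OF X c y V] by blast
    have "comp_in X E y = omega0_at X \<phi> x E"
      using fun_cong[OF e0y, of E] E(1) by (simp add: e0_def omega0_def)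
    then obtain n :: nat where "(\<lambda>t. \<phi> t x) ` {real n<..} \<subseteq> comp_in X E y"
      using theI'[OF omega0_at_ex1[OF F x E(1)]] by (auto simp: omega0_at_def)
    then have "\<phi> t x \<in> V" if "t > real n" for t using that E(2) by blast
    then show ?thesis by (auto simp: eventually_at_top_dense)
  qed
  then show ?thesis using yX by (auto simp: limitin_def simp flip: y_def)
qed

theorem theorem5p2:
  fixes X :: "'a ext_space" and \<phi> :: "real \<Rightarrow> 'a \<Rightarrow> 'a"
  assumes "r_exterior_flow X \<phi>" and "C0_complete X"
  shows "(\<forall>x\<in>points X.
            limitin (etop X) (\<lambda>t. \<phi> t x) (e0_inv X (omega0 X \<phi> x)) at_top \<and>
            e0_inv X (omega0 X \<phi> x) \<in> omega_limit (etop X) \<phi> x) \<and>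
         (Hausdorff_space (etop X) \<longrightarrow>
            (\<forall>x\<in>points X. omega_limit (etop X) \<phi> x = {e0_inv X (omega0 X \<phi> x)}) \<and>
            critical_points (etop X) \<phi> = periodic_points (etop X) \<phi> \<and>
            periodic_points (etop X) \<phi> = etop X closure_of Omega_limit (etop X) \<phi>)"
proof -
  have flow: "is_flow (etop X) \<phi>" using assms(1) by (simp add: r_exterior_flow_def)
  note lim = limitin_e0_inv_omega0[OF assms]
  have "e0_inv X (omega0 X \<phi> x) \<in> omega_limit (etop X) \<phi> x" if "x \<in> points X" for x
    using lim[OF that] by (rule limitin_in_omega_limit)
  moreover have "omega_limit (etop X) \<phi> x = {e0_inv X (omega0 X \<phi> x)}"
    if "Hausdorff_space (etop X)" "x \<in> points X" for x
    using that(1) lim[OF that(2)] by (rule omega_limit_Hausdorff_eq)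
  ultimately show ?thesis
    using lim convergent_flow_Hausdorff[OF _ flow lim] by simp
qed

end
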